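(* Let $\theta\in\mathbb{R}$, $w>0$ and $r_0>0$. For any initial values $y_0\in\mathbb{R}$ and $\theta_0\in\mathbb{R}$, there exists a real noise sequence $\{w_t\}_{t\ge 1}$ satisfying $|w_t|\le w$ for all $t\ge 1$ such that, for the resulting closed-loop system (the LS-based self-tuning system described in the context): (i) the LS estimate error $\tilde\theta_t=\theta-\theta_t$ diverges in the sense that $\limsup_{t\to+\infty}|\tilde\theta_t|=+\infty$; (ii) the outputs of the closed-loop system satisfy $$\limsup_{t\to+\infty}\frac{\sum_{i=1}^t y_i^2}{\sum_{i=1}^t w_i^2}=+\infty .$$
   Context: Consider the discrete-time single-input/single-output linear model $$y_{t+1}=\theta y_t+u_t+w_{t+1},\qquad t\ge 0,$$ where $y_t,u_t,w_t\in\mathbb{R}$ are the output, input and noise, and $\theta\in\mathbb{R}$ is an unknown parameter. The least-squares (LS) estimate $\theta_t$ of $\theta$ is defined recursively by $$\theta_{t+1}=\theta_t+\frac{1}{r_t}\,y_t\,(y_{t+1}-u_t-\theta_t y_t)\quad (t\ge 0),\qquad \frac1{r_t}=\frac1{r_{t-1}}-\frac{y_t^2}{r_{t-1}^2+r_{t-1}y_t^2}\quad (t\ge 1),$$ where $\theta_0\in\mathbb{R}$ and $r_0>0$ are deterministic initial values (so $r_t=r_{t-1}+y_t^2$ for $t\ge1$). The self-tuning feedback law is $u_t=-\theta_t y_t$. With $\tilde\theta_t=\theta-\theta_t$, the closed-loop system is $y_{t+1}=\tilde\theta_t y_t+w_{t+1}$, $t\ge0$. *)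

theory Defs
  imports "HOL-Analysis.Analysis"
begin

definition linear_model :: "real \<Rightarrow> (nat \<Rightarrow> real) \<Rightarrow> (nat \<Rightarrow> real) \<Rightarrow> (nat \<Rightarrow> real) \<Rightarrow> bool" where
  "linear_model \<theta> w u y \<longleftrightarrow> (\<forall>t. y (t + 1) = \<theta> * y t + u t + w (t + 1))"

text \<open>The recursion determines \<open>1 / r t\<close>. Since \<open>r 0 > 0\<close>, this fixes \<open>r t\<close> itself and no
  division by zero occurs: \<open>r t = r (t - 1) + (y t)\<^sup>2 > 0\<close> for \<open>t \<ge> 1\<close>. The value \<open>y 0\<close> enters
  the first estimate update but not \<open>r\<close>.\<close>

definition ls_estimate ::
  "real \<Rightarrow> real \<Rightarrow> (nat \<Rightarrow> real) \<Rightarrow> (nat \<Rightarrow> real) \<Rightarrow> (nat \<Rightarrow> real) \<Rightarrow> (nat \<Rightarrow> real) \<Rightarrow> bool" where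
  "ls_estimate \<theta>0 r0 u y r \<theta>h \<longleftrightarrow>
     \<theta>h 0 = \<theta>0 \<and> r 0 = r0 \<and>
     (\<forall>t. \<theta>h (t + 1) = \<theta>h t + 1 / r t * y t * (y (t + 1) - u t - \<theta>h t * y t)) \<and>
     (\<forall>t\<ge>1. 1 / r t = 1 / r (t - 1) - (y t)\<^sup>2 / ((r (t - 1))\<^sup>2 + r (t - 1) * (y t)\<^sup>2))"

definition self_tuning_feedback :: "(nat \<Rightarrow> real) \<Rightarrow> (nat \<Rightarrow> real) \<Rightarrow> (nat \<Rightarrow> real) \<Rightarrow> bool" where
  "self_tuning_feedback \<theta>h y u \<longleftrightarrow> (\<forall>t. u t = - \<theta>h t * y t)"

text \<open>For \<open>r0 > 0\<close>, the parameters \<open>\<theta> r0 y0 \<theta>0\<close> and the noise \<open>w\<close> (only \<open>w t\<close> with \<open>t \<ge> 1\<close>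
  matters) determine the trajectory \<open>u y r \<theta>h\<close> uniquely.\<close>

definition ls_self_tuning_system ::
  "real \<Rightarrow> real \<Rightarrow> real \<Rightarrow> real \<Rightarrow> (nat \<Rightarrow> real) \<Rightarrow>
   (nat \<Rightarrow> real) \<Rightarrow> (nat \<Rightarrow> real) \<Rightarrow> (nat \<Rightarrow> real) \<Rightarrow> (nat \<Rightarrow> real) \<Rightarrow> bool" where
  "ls_self_tuning_system \<theta> r0 y0 \<theta>0 w u y r \<theta>h \<longleftrightarrow>
     y 0 = y0 \<and> linear_model \<theta> w u y \<and> ls_estimate \<theta>0 r0 u y r \<theta>h \<and>
     self_tuning_feedback \<theta>h y u"

end

theory Submission
  imports Defs
begin

text \<open>Write \<open>e\<^sub>t = \<theta> - \<theta>\<^sub>t\<close>, so that \<open>y\<^sub>t\<^sub>+\<^sub>1 = e\<^sub>t y\<^sub>t + w\<^sub>t\<^sub>+\<^sub>1\<close> and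
  \<open>e\<^sub>t\<^sub>+\<^sub>1 = e\<^sub>t - y\<^sub>t y\<^sub>t\<^sub>+\<^sub>1 / r\<^sub>t\<close>. Outputs of alternating sign and constant size \<open>c\<close> raise \<open>e\<close> by
  \<open>\<Sum> c\<^sup>2 / r\<^sub>t = \<infinity>\<close>, and admissible noise produces them while \<open>c (1 + e) \<le> w\<close>. The noise energy
  spent on reaching a large error \<open>e\<close> is \<open>O(r e\<^sup>2)\<close>. Then the noise is switched off and the unstable
  loop overshoots until \<open>y\<^sup>2 / (r e\<^sup>2)\<close> is as large as desired. Both phases can be started from any
  state, hence repeated forever with growing targets.\<close>

section \<open>Scheduling infinitely many targets along one orbit\<close>

text \<open>Instead of concatenating finite paths, single steps are chosen while a counter names the
  current target. A step taken at a state meeting the target advances the counter; any other step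
  shortens the distance to the target, so no target is pursued forever.\<close>

lemma rtranclp_visits_all:
  fixes P :: "nat \<Rightarrow> 'a \<Rightarrow> bool"
  assumes reach: "\<And>n s. I s \<Longrightarrow> \<exists>s'. step\<^sup>*\<^sup>* s s' \<and> P n s'"
    and closed: "\<And>s s'. I s \<Longrightarrow> step s s' \<Longrightarrow> I s'"
    and total: "\<And>s. I s \<Longrightarrow> \<exists>s'. step s s'"
    and init: "I s0"
  shows "\<exists>x. x 0 = s0 \<and> (\<forall>t. step (x t) (x (Suc t))) \<and> (\<forall>n. \<exists>t\<ge>n. P n (x t))"
proof -
  \<comment> \<open>\<open>d n s\<close> is the length of a shortest path from \<open>s\<close> to
    \<open>P n\<close>. It is meaningful only if such a path exists, which \<open>reach\<close>
    ensures under \<open>I\<close>.\<close>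
  define d where "d n s = (LEAST k. \<exists>s'. (step ^^ k) s s' \<and> P n s')" for n s
  let ?Q = "\<lambda>p q. step (fst p) (fst q) \<and>
    (if P (snd p) (fst p) then snd q = Suc (snd p)
     else snd q = snd p \<and> d (snd p) (fst q) < d (snd p) (fst p))"
  have ex: "\<exists>q. I (fst q) \<and> ?Q p q" if I: "I (fst p)" for p :: "'a \<times> nat"
  proof -
    obtain s n where p: "p = (s, n)" by force
    show ?thesis
    proof (cases "P n s")
      case True
      obtain s' where "step s s'" using total I p by auto
      then show ?thesis using closed I p True by (intro exI[of _ "(s', Suc n)"]) auto
    next
      case False
      have "\<exists>k s'. (step ^^ k) s s' \<and> P n s'"
        using reach[of s n] I p by (auto simp: rtranclp_power)
      then have "\<exists>s'. (step ^^ d n s) s s' \<and> P n s'"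
        unfolding d_def by (rule LeastI_ex)
      then obtain s' where s': "(step ^^ d n s) s s'" "P n s'" by blast
      then obtain k where k: "d n s = Suc k" using False by (cases "d n s") auto
      then obtain s1 where s1: "step s s1" "(step ^^ k) s1 s'"
        using s' by (metis relpowp_Suc_D2)
      have "d n s1 \<le> k" unfolding d_def using s1 s' by (intro Least_le) blast
      then show ?thesis using closed I p s1 False k
        by (intro exI[of _ "(s1, n)"]) auto
    qed
  qed
  obtain z where z0: "z 0 = (s0, 0)" and z: "\<And>t. I (fst (z t))" "\<And>t. ?Q (z t) (z (Suc t))"
  proof -
    have "\<exists>f. \<forall>t. (I (fst (f t)) \<and> (t = 0 \<longrightarrow> f t = (s0, 0))) \<and> ?Q (f t) (f (Suc t))"
      by (rule dependent_nat_choice) (use init ex in force)+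
    then show thesis using that by blast
  qed
  have hit: "\<exists>t'\<ge>t. snd (z t') = n \<and> P n (fst (z t'))" if "snd (z t) = n" for t n
    using that
  proof (induction "d n (fst (z t))" arbitrary: t rule: less_induct)
    case less
    show ?case
    proof (cases "P n (fst (z t))")
      case True
      then show ?thesis using less.prems by blast
    next
      case False
      then have "snd (z (Suc t)) = n" "d n (fst (z (Suc t))) < d n (fst (z t))"
        using z(2)[of t] less.prems by auto
      from less.hyps[OF this(2,1)] show ?thesis using Suc_leD by blast
    qed
  qed
  have reached: "\<exists>t. snd (z t) = n" for n
  proof (induction n)
    case 0
    then show ?case using z0 by (intro exI[of _ 0]) auto
  next
    case (Suc n)
    then obtain t where "snd (z t) = n" "P n (fst (z t))" using hit by blast
    then have "snd (z (Suc t)) = Suc n" using z(2)[of t] by auto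
    then show ?case by blast
  qed
  \<comment> \<open>The counter rises by at most one per step, so it cannot equal \<open>n\<close>
    before time \<open>n\<close>. This gives the requirement \<open>t \<ge> n\<close>.\<close>
  have le: "snd (z t) \<le> t" for t
  proof (induction t)
    case 0
    then show ?case using z0 by simp
  next
    case (Suc t)
    then show ?case using z(2)[of t] by (auto split: if_splits)
  qed
  have "\<exists>t\<ge>n. P n (fst (z t))" for n
    using reached[of n] hit le by metis
  then show ?thesis using z0 z(2) by (intro exI[of _ "\<lambda>t. fst (z t)"]) auto
qed

lemma limsup_ereal_eq_infinity:
  fixes f :: "nat \<Rightarrow> real"
  assumes "\<And>n. \<exists>t\<ge>n. f t \<ge> real n"
  shows "limsup (\<lambda>t. ereal (f t)) = \<infinity>"
proof -
  have "limsup (\<lambda>t. ereal (f t)) \<ge> ereal (real k)" for k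
  proof (rule Limsup_greatest)
    fix Q assume "eventually Q sequentially"
    then obtain N where N: "\<And>t. t \<ge> N \<Longrightarrow> Q t" by (auto simp: eventually_sequentially)
    obtain t where t: "t \<ge> max N k" "f t \<ge> real (max N k)" using assms by blast
    then have "ereal (real k) \<le> ereal (f t)" by simp
    also have "\<dots> \<le> (SUP t\<in>Collect Q. ereal (f t))" using t N by (intro SUP_upper) auto
    finally show "ereal (real k) \<le> (SUP t\<in>Collect Q. ereal (f t))" .
  qed
  moreover have "\<exists>k::nat. ereal B \<le> ereal (real k)" for B
    using real_arch_simple[of B] by simp
  ultimately show ?thesis by (meson ereal_top order_trans)
qed

section \<open>State dynamics and behaviour without noise\<close>

text \<open>The state at time \<open>t \<ge> 1\<close> is \<open>(y\<^sub>t, \<theta> - \<theta>\<^sub>t, r\<^sub>t\<^sub>-\<^sub>1, w\<^sub>1\<^sup>2 + \<dots> + w\<^sub>t\<^sup>2)\<close>;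
  note the shifted index of \<open>r\<close>.\<close>

type_synonym state = "real \<times> real \<times> real \<times> real"

fun next_state :: "real \<Rightarrow> state \<Rightarrow> state" where
  "next_state w (y, e, R, W) = (e * y + w, e - y * (e * y + w) / (R + y\<^sup>2), R + y\<^sup>2, W + w\<^sup>2)"

definition admissible_step :: "real \<Rightarrow> state \<Rightarrow> state \<Rightarrow> bool" where
  "admissible_step v s s' \<longleftrightarrow> (\<exists>w. \<bar>w\<bar> \<le> v \<and> s' = next_state w s)"

text \<open>Without noise \<open>S = R e\<close> is conserved.\<close>

lemma noiseless_orbit:
  fixes y e R W v :: real
  assumes "R > 0" "v > 0"
  obtains Y Q :: "nat \<Rightarrow> real" where "Y 0 = y" "Q 0 = R"
    "\<And>n. Y (Suc n) = R * e / Q n * Y n" "\<And>n. Q (Suc n) = Q n + (Y n)\<^sup>2"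
    "\<And>n. R \<le> Q n"
    "\<And>n. (admissible_step v)\<^sup>*\<^sup>* (y, e, R, W) (Y n, R * e / Q n, Q n, W)"
proof -
  define z where "z = rec_nat (y, R) (\<lambda>_ (a, q). (R * e / q * a, q + a\<^sup>2))"
  define Y where "Y n = fst (z n)" for n
  define Q where "Q n = snd (z n)" for n
  have 0: "Y 0 = y" "Q 0 = R" by (auto simp: Y_def Q_def z_def)
  have Y: "Y (Suc n) = R * e / Q n * Y n" and Q: "Q (Suc n) = Q n + (Y n)\<^sup>2" for n
    by (auto simp: Y_def Q_def z_def split: prod.split)
  have ge: "R \<le> Q n" for n
    by (induction n) (auto simp: 0 Q intro: add_increasing2)
  have "(admissible_step v)\<^sup>*\<^sup>* (y, e, R, W) (Y n, R * e / Q n, Q n, W)" for n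
  proof (induction n)
    case 0
    then show ?case using assms by (simp add: \<open>Y 0 = y\<close> \<open>Q 0 = R\<close>)
  next
    case (Suc n)
    have pos: "Q n > 0" "Q (Suc n) > 0" using ge[of n] ge[of "Suc n"] assms by linarith+
    \<comment> \<open>The left side is \<open>R * e / Q n\<close> times
      \<open>1 - (Y n)\<^sup>2 / Q (Suc n)\<close>, and that factor equals
      \<open>Q n / Q (Suc n)\<close>.\<close>
    have *: "R * e / Q n - Y n * Y (Suc n) / Q (Suc n) = R * e / Q (Suc n)"
      using pos by (simp add: Y Q divide_simps power2_eq_square) (simp add: algebra_simps)
    have "next_state 0 (Y n, R * e / Q n, Q n, W) =
        (Y (Suc n), R * e / Q (Suc n), Q (Suc n), W)"
      unfolding next_state.simps add_0_right Y[symmetric] Q[symmetric] * by simp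
    then have "admissible_step v (Y n, R * e / Q n, Q n, W)
        (Y (Suc n), R * e / Q (Suc n), Q (Suc n), W)"
      unfolding admissible_step_def using assms by (metis abs_zero less_imp_le)
    with Suc show ?case by (rule rtranclp.rtrancl_into_rtrancl)
  qed
  with that 0 Y Q ge show thesis by blast
qed

text \<open>If the outputs stayed above \<open>\<epsilon>\<close>, then \<open>Q\<close> would grow
  at least linearly, the multiplier \<open>R * e / Q n\<close> would eventually be at most 1/2 in
  size, and the outputs would decay geometrically after all. The lemma makes the output small enough
  to be steered, at no cost in noise energy.\<close>

lemma output_decays:
  fixes y e R W v :: real
  assumes "R > 0" "v > 0" "\<epsilon> > 0"
  obtains y' e' R' where "(admissible_step v)\<^sup>*\<^sup>* (y, e, R, W) (y', e', R', W)"
    "\<bar>y'\<bar> \<le> \<epsilon>" "\<bar>e'\<bar> \<le> \<bar>e\<bar>" "R \<le> R'"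
proof -
  obtain Y Q where Y0: "Y 0 = y" and Q0: "Q 0 = R"
    and Y: "\<And>n. Y (Suc n) = R * e / Q n * Y n" and Q: "\<And>n. Q (Suc n) = Q n + (Y n)\<^sup>2"
    and ge: "\<And>n. R \<le> Q n"
    and reach: "\<And>n. (admissible_step v)\<^sup>*\<^sup>* (y, e, R, W) (Y n, R * e / Q n, Q n, W)"
    using noiseless_orbit[OF assms(1,2)] by metis
  have "\<exists>n. \<bar>Y n\<bar> \<le> \<epsilon>"
  proof (rule ccontr)
    assume "\<not> ?thesis"
    then have big: "\<bar>Y n\<bar> > \<epsilon>" for n by (simp add: not_le)
    have Qlin: "Q n \<ge> n * \<epsilon>\<^sup>2" for n
    proof (induction n)
      case (Suc n)
      have "\<epsilon>\<^sup>2 \<le> (Y n)\<^sup>2" using big[of n] assms(3) by (simp add: abs_le_square_iff[symmetric])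
      with Suc show ?case by (simp add: Q algebra_simps)
    qed (use Q0 assms in simp)
    obtain N :: nat where N: "N * \<epsilon>\<^sup>2 \<ge> 2 * \<bar>R * e\<bar>"
      using ex_less_of_nat_mult[of "\<epsilon>\<^sup>2" "2 * \<bar>R * e\<bar>"] assms(3) by (auto intro: less_imp_le)
    have half: "\<bar>Y (Suc n)\<bar> \<le> \<bar>Y n\<bar> / 2" if "n \<ge> N" for n
    proof -
      have "real N * \<epsilon>\<^sup>2 \<le> real n * \<epsilon>\<^sup>2" using that by (intro mult_right_mono) auto
      then have "2 * \<bar>R * e\<bar> \<le> Q n" using N Qlin[of n] by linarith
      moreover have "Q n > 0" using ge[of n] assms by linarith
      ultimately have "\<bar>R * e / Q n\<bar> \<le> 1 / 2" by (simp add: abs_divide divide_simps)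
      then have "\<bar>R * e / Q n\<bar> * \<bar>Y n\<bar> \<le> 1 / 2 * \<bar>Y n\<bar>" by (intro mult_right_mono) auto
      then show ?thesis by (simp add: Y abs_mult)
    qed
    have geo: "\<bar>Y (N + k)\<bar> \<le> \<bar>Y N\<bar> * (1 / 2) ^ k" for k
    proof (induction k)
      case (Suc k)
      then show ?case using half[of "N + k"] by simp
    qed simp
    have "(\<lambda>k. \<bar>Y N\<bar> * (1 / 2) ^ k) \<longlonglongrightarrow> \<bar>Y N\<bar> * 0"
      by (intro tendsto_mult tendsto_const LIMSEQ_power_zero) simp
    then have "\<forall>\<^sub>F k in sequentially. \<bar>Y N\<bar> * (1 / 2) ^ k < \<epsilon>"
      using assms(3) by (intro order_tendstoD(2)) auto
    then obtain k where "\<bar>Y N\<bar> * (1 / 2) ^ k < \<epsilon>" by (auto simp: eventually_sequentially)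
    with geo[of k] big[of "N + k"] show False by linarith
  qed
  then obtain n where n: "\<bar>Y n\<bar> \<le> \<epsilon>" by blast
  have "R / Q n \<le> 1" "R / Q n \<ge> 0" using ge[of n] assms by (auto simp: divide_simps)
  then have "R / Q n * \<bar>e\<bar> \<le> 1 * \<bar>e\<bar>" by (intro mult_right_mono) auto
  moreover have "\<bar>R * e / Q n\<bar> = R / Q n * \<bar>e\<bar>"
    using assms ge[of n] by (simp add: abs_mult)
  ultimately show thesis using that[OF reach n _ ge] by simp
qed

text \<open>As long as the squared outputs are below \<open>R / 2\<close>, the multiplier is at
  least 2. Stopping at the first crossing of \<open>R / 2\<close> keeps \<open>R'\<close> at most
  \<open>2 * R\<close>, so the error is at least half its initial value.\<close>

lemma output_grows:
  fixes y e R W v :: real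
  assumes "R > 0" "v > 0" "e \<ge> 4" "y \<noteq> 0"
  obtains y' R' where "(admissible_step v)\<^sup>*\<^sup>* (y, e, R, W) (y', R * e / R', R', W)"
    "R \<le> R'" "R' \<le> 2 * R" "R / 2 \<le> y'\<^sup>2"
proof -
  obtain Y Q where Y0: "Y 0 = y" and Q0: "Q 0 = R"
    and Y: "\<And>n. Y (Suc n) = R * e / Q n * Y n" and Q: "\<And>n. Q (Suc n) = Q n + (Y n)\<^sup>2"
    and ge: "\<And>n. R \<le> Q n"
    and reach: "\<And>n. (admissible_step v)\<^sup>*\<^sup>* (y, e, R, W) (Y n, R * e / Q n, Q n, W)"
    using noiseless_orbit[OF assms(1,2)] by metis
  \<comment> \<open>Squared outputs at least quadruple, so each one dominates the sum of all earlier
    ones. This bounds \<open>Q n\<close> by \<open>3 * R / 2\<close> before the crossing, which in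
    turn keeps the multiplier at least 2.\<close>
  have inv: "Q n - R \<le> (Y n)\<^sup>2 \<and> 4 ^ n * y\<^sup>2 \<le> (Y n)\<^sup>2" if "\<And>m. m < n \<Longrightarrow> (Y m)\<^sup>2 < R / 2" for n
    using that
  proof (induction n)
    case (Suc n)
    then have IH: "Q n - R \<le> (Y n)\<^sup>2" "4 ^ n * y\<^sup>2 \<le> (Y n)\<^sup>2" and small: "(Y n)\<^sup>2 < R / 2"
      using less_Suc_eq by auto
    have "Q n > 0" using ge[of n] assms by linarith
    moreover have "R * 4 \<le> R * e" using assms by (intro mult_left_mono) auto
    then have "2 * Q n \<le> R * e" using IH small assms by linarith
    ultimately have "2 \<le> R * e / Q n" by (simp add: divide_simps)
    then have "2\<^sup>2 * (Y n)\<^sup>2 \<le> (R * e / Q n)\<^sup>2 * (Y n)\<^sup>2"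
      by (intro mult_right_mono power_mono) auto
    then have four: "4 * (Y n)\<^sup>2 \<le> (Y (Suc n))\<^sup>2" unfolding Y power_mult_distrib by simp
    then have "Q (Suc n) - R \<le> (Y (Suc n))\<^sup>2"
      using IH(1) zero_le_power2[of "Y n"] unfolding Q by linarith
    with four IH(2) show ?case by simp
  qed (simp add: Y0 Q0)
  have ex: "\<exists>n. R / 2 \<le> (Y n)\<^sup>2"
  proof (rule ccontr)
    assume "\<not> ?thesis"
    then have lt: "(Y m)\<^sup>2 < R / 2" for m by (simp add: not_le)
    obtain n where "R / 2 / y\<^sup>2 < 4 ^ n" using real_arch_pow[of 4 "R / 2 / y\<^sup>2"] by auto
    then have "R / 2 < 4 ^ n * y\<^sup>2" using assms by (simp add: divide_simps split: if_splits)
    with inv[of n] lt show False by (metis less_le_trans not_less_iff_gr_or_eq order_le_less_trans)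
  qed
  define n where "n = (LEAST n. R / 2 \<le> (Y n)\<^sup>2)"
  have n: "R / 2 \<le> (Y n)\<^sup>2" unfolding n_def using ex by (rule LeastI_ex)
  have before: "(Y m)\<^sup>2 < R / 2" if "m < n" for m
    using not_less_Least[OF that[unfolded n_def]] by (simp add: not_le)
  have "Q n \<le> 2 * R"
  proof (cases n)
    case (Suc m)
    then show ?thesis using inv[of m] before by (force simp: Q)
  qed (use Q0 assms in simp)
  then show thesis using that reach ge n by blast
qed

section \<open>Raising the error with bounded noise\<close>

lemma sum_inverse_shift_unbounded:
  fixes a B :: real
  assumes "a \<ge> 0"
  shows "\<exists>n. (\<Sum>i<n. 1 / (a + real (Suc i))) \<ge> B"
proof (rule ccontr)
  assume "\<not> ?thesis"
  then have "(\<Sum>i<n. 1 / (a + real (Suc i))) \<le> B" for n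
    by (meson linear)
  then have "summable (\<lambda>i. 1 / (a + real (Suc i)))"
    using assms by (intro summableI_nonneg_bounded[where x = B]) auto
  then have s: "summable (\<lambda>i. (a + 1) * (1 / (a + real (Suc i))))"
    by (rule summable_mult)
  have "summable (\<lambda>i. 1 / real (Suc i))"
  proof (rule summable_comparison_test'[OF s, of 0])
    fix i :: nat
    have "a + real (Suc i) \<le> (a + 1) * real (Suc i)"
      using assms by (simp add: algebra_simps)
    then show "norm (1 / real (Suc i)) \<le> (a + 1) * (1 / (a + real (Suc i)))"
      using assms by (simp add: divide_simps)
  qed
  then show False using not_summable_harmonic[where 'a = real]
    by (subst (asm) summable_Suc_iff) (simp add: inverse_eq_divide)
qed

text \<open>The noise \<open>w = - (1 + e) y\<close> flips the sign of the output; the error then increases by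
  \<open>y\<^sup>2 / (R + n y\<^sup>2)\<close> at the \<open>n\<close>-th step, a divergent series.\<close>

lemma alternating_output_raises_error:
  fixes y e R W v E :: real
  assumes "R > 0" "y \<noteq> 0" "\<bar>e\<bar> \<le> E" "\<bar>y\<bar> * (E + 1) \<le> v"
  obtains y' e' R' W' where "(admissible_step v)\<^sup>*\<^sup>* (y, e, R, W) (y', e', R', W')"
    "y' \<noteq> 0" "E \<le> e'" "R \<le> R'" "W' - W \<le> (R' - R) * (E + 1)\<^sup>2"
proof -
  \<comment> \<open>The increment \<open>y\<^sup>2 / (R + (i + 1) * y\<^sup>2)\<close>, divided
    through by \<open>y\<^sup>2\<close>, is a term of the harmonic series shifted by
    \<open>R / y\<^sup>2\<close>.\<close>
  define h where "h n = (\<Sum>i<n. 1 / (R / y\<^sup>2 + real (Suc i)))" for n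
  have h0: "h n \<ge> 0" for n unfolding h_def using assms by (intro sum_nonneg) auto
  have path: "\<exists>W'. (admissible_step v)\<^sup>*\<^sup>* (y, e, R, W) ((- 1) ^ n * y, e + h n, R + n * y\<^sup>2, W')
      \<and> W' - W \<le> n * y\<^sup>2 * (E + 1)\<^sup>2"
    if "\<And>m. m < n \<Longrightarrow> e + h m < E" for n
    using that
  proof (induction n)
    case 0
    then show ?case by (intro exI[of _ W]) (simp add: h_def)
  next
    case (Suc n)
    then obtain W' where
      W': "(admissible_step v)\<^sup>*\<^sup>* (y, e, R, W) ((- 1) ^ n * y, e + h n, R + n * y\<^sup>2, W')"
      "W' - W \<le> n * y\<^sup>2 * (E + 1)\<^sup>2"
      by auto
    define z where "z = (- 1) ^ n * y"
    define w where "w = - (1 + (e + h n)) * z"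
    have z2: "z\<^sup>2 = y\<^sup>2" by (simp add: z_def power_mult_distrib flip: power_mult)
    have absz: "\<bar>z\<bar> = \<bar>y\<bar>" by (simp add: z_def abs_mult power_abs)
    \<comment> \<open>The upper bound holds because \<open>E\<close> has not been reached yet, the
      lower one because \<open>h n\<close> is nonnegative and \<open>e\<close> is at least
      \<open>- E\<close>.\<close>
    have gain: "\<bar>1 + (e + h n)\<bar> \<le> E + 1" using Suc.prems[of n] h0[of n] assms(3) by auto
    have "\<bar>w\<bar> \<le> (E + 1) * \<bar>y\<bar>" unfolding w_def abs_mult abs_minus absz
      using gain by (intro mult_right_mono) auto
    then have wv: "\<bar>w\<bar> \<le> v" using assms(4) by (simp add: mult.commute)
    have "w\<^sup>2 = \<bar>1 + (e + h n)\<bar>\<^sup>2 * y\<^sup>2" by (simp add: w_def power_mult_distrib z2 power2_commute)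
      (simp add: power2_eq_square algebra_simps)
    also have "\<dots> \<le> (E + 1)\<^sup>2 * y\<^sup>2" using gain by (intro mult_right_mono power_mono) auto
    finally have w2: "w\<^sup>2 \<le> (E + 1)\<^sup>2 * y\<^sup>2" .
    have z': "(e + h n) * z + w = - z" by (simp add: w_def algebra_simps)
    have "R + real n * y\<^sup>2 + y\<^sup>2 > 0" using assms by (intro add_pos_nonneg) auto
    moreover have "h (Suc n) - h n = 1 / (R / y\<^sup>2 + real (Suc n))" by (simp add: h_def)
    moreover have "\<dots> = y\<^sup>2 / (R + real n * y\<^sup>2 + y\<^sup>2)"
      using assms by (simp add: field_simps)
    ultimately have e': "e + h n - z * (- z) / (R + real n * y\<^sup>2 + y\<^sup>2) = e + h (Suc n)"
      using z2 by (simp add: power2_eq_square)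
    have "next_state w (z, e + h n, R + n * y\<^sup>2, W') =
        ((- 1) ^ Suc n * y, e + h (Suc n), R + Suc n * y\<^sup>2, W' + w\<^sup>2)"
      unfolding next_state.simps z' z2 e' by (simp add: z_def algebra_simps)
    then have "admissible_step v (z, e + h n, R + n * y\<^sup>2, W')
        ((- 1) ^ Suc n * y, e + h (Suc n), R + Suc n * y\<^sup>2, W' + w\<^sup>2)"
      unfolding admissible_step_def using wv by metis
    then have "(admissible_step v)\<^sup>*\<^sup>* (y, e, R, W)
        ((- 1) ^ Suc n * y, e + h (Suc n), R + Suc n * y\<^sup>2, W' + w\<^sup>2)"
      using W'(1) unfolding z_def by (rule rtranclp.rtrancl_into_rtrancl[rotated])
    moreover have "W' + w\<^sup>2 - W \<le> Suc n * y\<^sup>2 * (E + 1)\<^sup>2"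
      using W'(2) w2 by (simp add: algebra_simps)
    ultimately show ?case by blast
  qed
  have ex: "\<exists>n. E \<le> e + h n"
    using sum_inverse_shift_unbounded[of "R / y\<^sup>2" "E - e"] assms
    by (auto simp: h_def algebra_simps)
  define n where "n = (LEAST n. E \<le> e + h n)"
  have n: "E \<le> e + h n" unfolding n_def using ex by (rule LeastI_ex)
  have "e + h m < E" if "m < n" for m
    using not_less_Least[OF that[unfolded n_def]] by (simp add: not_le)
  from path[OF this] obtain W' where
    "(admissible_step v)\<^sup>*\<^sup>* (y, e, R, W) ((- 1) ^ n * y, e + h n, R + n * y\<^sup>2, W')"
    "W' - W \<le> n * y\<^sup>2 * (E + 1)\<^sup>2" by blast
  then show thesis using that n assms by simp
qed

text \<open>Three phases: let the output decay without noise, use one noise value to set it to a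
  small constant \<open>c\<close>, then alternate its sign until the error passes \<open>E\<close>.
  The alternation spends energy at most \<open>(E + 1)\<^sup>2\<close> times the growth of
  \<open>R\<close>, whence the bound on \<open>W'\<close>.\<close>

lemma error_reaches:
  fixes y e R W v B :: real
  assumes "R > 0" "v > 0"
  obtains y' e' R' W' where "(admissible_step v)\<^sup>*\<^sup>* (y, e, R, W) (y', e', R', W')"
    "y' \<noteq> 0" "B \<le> e'" "R' > 0" "W' \<le> 5 * R' * e'\<^sup>2"
proof -
  \<comment> \<open>The entry \<open>\<bar>e\<bar> + 1\<close> leaves room for an error change of at
    most 1 while steering to \<open>c\<close>. The last entry makes the energy spent before the
    alternation at most \<open>R * E\<close>.\<close>
  define E where "E = Max {B, \<bar>e\<bar> + 1, 1, (W + v\<^sup>2) / R}"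
  have E: "B \<le> E" "\<bar>e\<bar> + 1 \<le> E" "1 \<le> E" "(W + v\<^sup>2) / R \<le> E" by (auto simp: E_def)
  define c where "c = v / (2 * (E + 1))"
  have c: "c > 0" "c * (E + 1) \<le> v" "c \<le> v / 2" using assms E(3) by (auto simp: c_def field_simps)
  \<comment> \<open>The first bound keeps the steering noise \<open>c - e1 * y1\<close> within
    \<open>v\<close>, the second keeps the resulting error change within 1.\<close>
  define \<epsilon> where "\<epsilon> = min (v / (2 * E)) (R / c)"
  have \<epsilon>: "\<epsilon> > 0" "\<epsilon> * E \<le> v / 2" "\<epsilon> * c \<le> R"
  proof -
    show "\<epsilon> > 0" using assms c E(3) by (auto simp: \<epsilon>_def)
    have "\<epsilon> * E \<le> v / (2 * E) * E" using E(3) by (intro mult_right_mono) (auto simp: \<epsilon>_def)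
    then show "\<epsilon> * E \<le> v / 2" using E(3) by simp
    have "\<epsilon> * c \<le> R / c * c" using c by (intro mult_right_mono) (auto simp: \<epsilon>_def)
    then show "\<epsilon> * c \<le> R" using c by simp
  qed
  obtain y1 e1 R1 where 1: "(admissible_step v)\<^sup>*\<^sup>* (y, e, R, W) (y1, e1, R1, W)"
    "\<bar>y1\<bar> \<le> \<epsilon>" "\<bar>e1\<bar> \<le> \<bar>e\<bar>" "R \<le> R1"
    using output_decays[OF assms \<epsilon>(1)] by metis
  define w where "w = c - e1 * y1"
  define R2 where "R2 = R1 + y1\<^sup>2"
  define e2 where "e2 = e1 - y1 * c / R2"
  have R2: "R \<le> R2" using 1 by (auto simp: R2_def intro: add_increasing2)
  have "\<bar>e1 * y1\<bar> \<le> E * \<epsilon>" unfolding abs_mult using 1 E by (intro mult_mono) auto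
  then have w: "\<bar>w\<bar> \<le> v" using \<epsilon>(2) c by (simp add: w_def mult.commute)
  have "\<bar>y1 * c\<bar> \<le> R2"
  proof -
    have "\<bar>y1 * c\<bar> \<le> \<epsilon> * c" using 1 c by (simp add: abs_mult)
    then show ?thesis using \<epsilon>(3) R2 by linarith
  qed
  then have "\<bar>y1 * c / R2\<bar> \<le> 1" using R2 assms by (simp add: divide_simps)
  then have e2: "\<bar>e2\<bar> \<le> E" using 1(3) E(2) unfolding e2_def by linarith
  have "next_state w (y1, e1, R1, W) = (c, e2, R2, W + w\<^sup>2)"
    by (simp add: w_def e2_def R2_def)
  then have "admissible_step v (y1, e1, R1, W) (c, e2, R2, W + w\<^sup>2)"
    unfolding admissible_step_def using w by metis
  with 1(1) have 2: "(admissible_step v)\<^sup>*\<^sup>* (y, e, R, W) (c, e2, R2, W + w\<^sup>2)"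
    by (rule rtranclp.rtrancl_into_rtrancl)
  have "R2 > 0" "c \<noteq> 0" "\<bar>c\<bar> * (E + 1) \<le> v" using R2 assms c by auto
  then obtain y3 e3 R3 W3 where 3:
    "(admissible_step v)\<^sup>*\<^sup>* (c, e2, R2, W + w\<^sup>2) (y3, e3, R3, W3)"
    "y3 \<noteq> 0" "E \<le> e3" "R2 \<le> R3" "W3 - (W + w\<^sup>2) \<le> (R3 - R2) * (E + 1)\<^sup>2"
    using alternating_output_raises_error[OF _ _ e2] by metis
  have "W + w\<^sup>2 \<le> W + v\<^sup>2" using w by (simp add: abs_le_square_iff[symmetric])
  also have "\<dots> \<le> R * E" using E(4) assms by (simp add: divide_simps mult.commute)
  also have "\<dots> \<le> R3 * e3\<^sup>2"
  proof (rule mult_mono)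
    have "e3 * 1 \<le> e3 * e3" using 3 E by (intro mult_left_mono) auto
    then show "E \<le> e3\<^sup>2" using 3 by (simp add: power2_eq_square)
  qed (use R2 3 assms E in auto)
  finally have a: "W + w\<^sup>2 \<le> R3 * e3\<^sup>2" .
  have b: "(R3 - R2) * (E + 1)\<^sup>2 \<le> R3 * (2 * e3)\<^sup>2"
    using 3 E R2 assms by (intro mult_mono power_mono) auto
  \<comment> \<open>The factor 5 is 1 for the earlier energy plus 4 from
    \<open>E + 1 \<le> 2 * e3\<close>.\<close>
  have W3: "W3 \<le> 5 * R3 * e3\<^sup>2" using 3(5) a b by (simp add: power_mult_distrib)
  show thesis
  proof (rule that)
    show "(admissible_step v)\<^sup>*\<^sup>* (y, e, R, W) (y3, e3, R3, W3)"
      using 2 3(1) by (rule rtranclp_trans)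
  qed (use W3 3 E R2 assms in auto)
qed

section \<open>Output energy against noise energy\<close>

text \<open>At large error \<open>e\<close> the noise is switched off once \<open>W = O(R e\<^sup>2)\<close>. The output then grows
  until it is of order at least \<open>R\<^sup>1\<^sup>/\<^sup>2\<close>; unless it already overshoots, two more steps multiply it
  by a factor of order \<open>e\<^sup>2\<close>, so that \<open>y\<^sup>2\<close> is of order \<open>R e\<^sup>4\<close>.\<close>

lemma output_dominates_noise:
  fixes y e R W v M :: real
  assumes "R > 0" "v > 0" "M \<ge> 0"
  obtains y' e' R' W' where "(admissible_step v)\<^sup>*\<^sup>* (y, e, R, W) (y', e', R', W')"
    "M * W' \<le> y'\<^sup>2"
proof -
  define N where "N = max M 1"
  \<comment> \<open>With this threshold, \<open>K * R1 \<le> y2\<^sup>2\<close> makes the next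
    squared output at least \<open>e1\<^sup>2 / 4 * K * R1\<close>, which is
    \<open>5 * N * R1 * e1\<^sup>2\<close> and hence at least \<open>M * W1\<close>.\<close>
  define K where "K = 20 * N"
  have N: "N \<ge> 1" "M \<le> N" by (auto simp: N_def)
  obtain y1 e1 R1 W1 where 1: "(admissible_step v)\<^sup>*\<^sup>* (y, e, R, W) (y1, e1, R1, W1)"
    "y1 \<noteq> 0" "8 * N * (2 + K) \<le> e1" "R1 > 0" "W1 \<le> 5 * R1 * e1\<^sup>2"
    using error_reaches[OF assms(1,2)] by metis
  have "8 * 1 * (2 + 0) \<le> 8 * N * (2 + K)" using N by (intro mult_mono) (auto simp: K_def)
  from order_trans[OF this 1(3)] have e1: "e1 \<ge> 4" by simp
  obtain y2 R2 where 2: "(admissible_step v)\<^sup>*\<^sup>* (y1, e1, R1, W1) (y2, R1 * e1 / R2, R2, W1)"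
    "R1 \<le> R2" "R2 \<le> 2 * R1" "R1 / 2 \<le> y2\<^sup>2"
    using output_grows[OF 1(4) assms(2) e1 1(2)] by metis
  have R2: "R2 > 0" using 1 2 by linarith
  obtain Y Q where Y0: "Y 0 = y2" and Q0: "Q 0 = R2"
    and Y: "\<And>n. Y (Suc n) = R2 * (R1 * e1 / R2) / Q n * Y n"
    and Q: "\<And>n. Q (Suc n) = Q n + (Y n)\<^sup>2"
    and reach: "\<And>n. (admissible_step v)\<^sup>*\<^sup>* (y2, R1 * e1 / R2, R2, W1)
      (Y n, R2 * (R1 * e1 / R2) / Q n, Q n, W1)"
    using noiseless_orbit[OF R2 assms(2), where y = y2 and e = "R1 * e1 / R2" and W = W1]
    by metis
  have Y1: "(Y 1)\<^sup>2 \<ge> e1\<^sup>2 / 4 * y2\<^sup>2"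
  proof -
    have "R2 * e1 \<le> 2 * R1 * e1" using 2 e1 by (intro mult_right_mono) auto
    then have "e1 / 2 \<le> R1 * e1 / R2" using R2 by (simp add: divide_simps mult_ac)
    then have "(e1 / 2)\<^sup>2 * y2\<^sup>2 \<le> (R1 * e1 / R2)\<^sup>2 * y2\<^sup>2"
      using e1 by (intro mult_right_mono power_mono) auto
    then show ?thesis using R2 Y[of 0] by (simp add: Y0 Q0 power_mult_distrib power_divide)
  qed
  have target: "M * W1 \<le> z" if "5 * N * R1 * e1\<^sup>2 \<le> z" for z
  proof -
    have "M * W1 \<le> M * (5 * R1 * e1\<^sup>2)" using 1 assms by (intro mult_left_mono) auto
    also have "\<dots> \<le> N * (5 * R1 * e1\<^sup>2)" using 1 N by (intro mult_right_mono) auto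
    finally show ?thesis using that by simp
  qed
  have "\<exists>n. M * W1 \<le> (Y n)\<^sup>2"
  proof (cases "K * R1 \<le> y2\<^sup>2")
    case True
    then have "e1\<^sup>2 / 4 * (K * R1) \<le> e1\<^sup>2 / 4 * y2\<^sup>2" by (intro mult_left_mono) auto
    with Y1 have "5 * N * R1 * e1\<^sup>2 \<le> (Y 1)\<^sup>2" by (simp add: K_def algebra_simps)
    then show ?thesis using target by auto
  next
    case False
    \<comment> \<open>Without overshoot \<open>Q 1\<close> is at most \<open>(2 + K) * R1\<close>,
      so the bound \<open>8 * N * (2 + K) \<le> e1\<close> makes the second multiplier at least
      \<open>8 * N\<close>.\<close>
    have Q1: "Q 1 \<le> (2 + K) * R1" "Q 1 > 0" using False Q[of 0] 2 R2
      by (auto simp: Q0 Y0 algebra_simps intro: add_pos_nonneg)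
    have "e1 * Q 1 \<le> e1 * ((2 + K) * R1)" using Q1 e1 by (intro mult_left_mono) auto
    moreover have K: "2 + K > 0" using N by (simp add: K_def)
    ultimately have "e1 / (2 + K) \<le> R1 * e1 / Q 1"
      using Q1 by (simp add: divide_simps algebra_simps)
    moreover have "8 * N \<le> e1 / (2 + K)" using 1(3) K by (simp add: field_simps)
    ultimately have "8 * N \<le> R1 * e1 / Q 1" by linarith
    then have "(8 * N)\<^sup>2 \<le> (R1 * e1 / Q 1)\<^sup>2" using N by (intro power_mono) auto
    moreover have "64 * N \<le> (8 * N)\<^sup>2" using N by (simp add: power2_eq_square)
    ultimately have "64 * N \<le> (R1 * e1 / Q 1)\<^sup>2" by linarith
    moreover have "e1\<^sup>2 / 4 * (R1 / 2) \<le> e1\<^sup>2 / 4 * y2\<^sup>2" using 2 by (intro mult_left_mono) auto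
    then have "e1\<^sup>2 * R1 / 8 \<le> (Y 1)\<^sup>2" using Y1 by (simp add: mult_ac)
    ultimately have "64 * N * (e1\<^sup>2 * R1 / 8) \<le> (R1 * e1 / Q 1)\<^sup>2 * (Y 1)\<^sup>2"
      using N 1 by (intro mult_mono) auto
    also have "\<dots> = (Y 2)\<^sup>2" using Y[of 1] R2 by (simp add: power_mult_distrib numeral_2_eq_2)
    finally have "8 * (N * R1 * e1\<^sup>2) \<le> (Y 2)\<^sup>2" by (simp add: algebra_simps)
    moreover have "N * R1 * e1\<^sup>2 \<ge> 0" using N 1 by auto
    ultimately have "5 * N * R1 * e1\<^sup>2 \<le> (Y 2)\<^sup>2" by linarith
    then show ?thesis using target by auto
  qed
  then obtain n where "M * W1 \<le> (Y n)\<^sup>2" by blast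
  then show thesis using that 1(1) 2(1) reach[of n] by (meson rtranclp_trans)
qed

section \<open>From a state orbit back to the closed-loop system\<close>

theorem theorem1:
  fixes \<theta> wmax r0 y0 \<theta>0 :: real
  assumes "wmax > 0" and "r0 > 0"
  shows "\<exists>w u y r \<theta>h :: nat \<Rightarrow> real.
           (\<forall>t\<ge>1. \<bar>w t\<bar> \<le> wmax) \<and>
           ls_self_tuning_system \<theta> r0 y0 \<theta>0 w u y r \<theta>h \<and>
           limsup (\<lambda>t. ereal \<bar>\<theta> - \<theta>h t\<bar>) = \<infinity> \<and>
           limsup (\<lambda>t. ereal ((\<Sum>i=1..t. (y i)\<^sup>2) / (\<Sum>i=1..t. (w i)\<^sup>2))) = \<infinity>"
proof -
  \<comment> \<open>Positivity of \<open>W\<close> makes the noise sums legitimate denominators;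
    \<open>r0 \<le> R\<close> gives positive \<open>R\<close>.\<close>
  define I where "I = (\<lambda>(y :: real, e :: real, R :: real, W :: real). r0 \<le> R \<and> 0 < W)"
  \<comment> \<open>Parity interleaves the two goals: even targets serve the error, odd ones the
    energy ratio.\<close>
  define P where "P n = (\<lambda>(y :: real, e :: real, R :: real, W :: real).
      if even n then real n \<le> e else real n * W \<le> y\<^sup>2)" for n :: nat
  \<comment> \<open>The first transition is made by hand with noise \<open>wmax\<close>, because
    \<open>y0\<close> enters the estimate but not \<open>r\<close>: the denominator is
    \<open>r0\<close> alone. The energy then starts at \<open>wmax\<^sup>2 > 0\<close>.\<close>
  define e1 where "e1 = \<theta> - \<theta>0 - y0 * ((\<theta> - \<theta>0) * y0 + wmax) / r0"
  have reach: "\<exists>s'. (admissible_step wmax)\<^sup>*\<^sup>* s s' \<and> P n s'" if "I s" for n s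
  proof -
    obtain y e R W where s: "s = (y, e, R, W)" by (cases s)
    have R: "R > 0" using that assms by (simp add: I_def s)
    show ?thesis
    proof (cases "even n")
      case True
      then show ?thesis using error_reaches[OF R assms(1), of y e W "real n"]
        unfolding s P_def by (metis (mono_tags, lifting) case_prod_conv)
    next
      case False
      then show ?thesis using output_dominates_noise[OF R assms(1), of "real n" y e W]
        unfolding s P_def by (metis (mono_tags, lifting) case_prod_conv of_nat_0_le_iff)
    qed
  qed
  have closed: "I s'" if "I s" "admissible_step wmax s s'" for s s'
    using that
    by (cases s) (auto simp: I_def admissible_step_def intro: add_increasing2 add_pos_nonneg)
  have total: "\<exists>s'. admissible_step wmax s s'" if "I s" for s
    unfolding admissible_step_def using assms by (intro exI[of _ "next_state 0 s"] exI[of _ 0]) auto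
  have init: "I ((\<theta> - \<theta>0) * y0 + wmax, e1, r0, wmax\<^sup>2)"
    using assms by (simp add: I_def)
  have "\<exists>x. x 0 = ((\<theta> - \<theta>0) * y0 + wmax, e1, r0, wmax\<^sup>2) \<and>
      (\<forall>t. admissible_step wmax (x t) (x (Suc t))) \<and> (\<forall>n. \<exists>t\<ge>n. P n (x t))"
    by (rule rtranclp_visits_all[where I = I]) (fact reach closed total init)+
  then obtain x where x0: "x 0 = ((\<theta> - \<theta>0) * y0 + wmax, e1, r0, wmax\<^sup>2)"
    and x: "\<And>t. admissible_step wmax (x t) (x (Suc t))" and P: "\<And>n. \<exists>t\<ge>n. P n (x t)"
    by blast
  have I: "I (x t)" for t
    by (induction t) (use init x0 closed x in auto)
  have "\<exists>v. \<forall>t. \<bar>v t\<bar> \<le> wmax \<and> x (Suc t) = next_state (v t) (x t)"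
    by (rule choice) (use x in \<open>auto simp: admissible_step_def\<close>)
  then obtain v where v: "\<And>t. \<bar>v t\<bar> \<le> wmax" "\<And>t. x (Suc t) = next_state (v t) (x t)"
    by blast
  define xy where "xy t = fst (x t)" for t
  define xe where "xe t = fst (snd (x t))" for t
  define xR where "xR t = fst (snd (snd (x t)))" for t
  define xW where "xW t = snd (snd (snd (x t)))" for t
  have xeq: "x t = (xy t, xe t, xR t, xW t)" for t
    by (simp add: xy_def xe_def xR_def xW_def)
  have xs: "xy (Suc t) = xe t * xy t + v t" "xR (Suc t) = xR t + (xy t)\<^sup>2"
    "xe (Suc t) = xe t - xy t * xy (Suc t) / xR (Suc t)" "xW (Suc t) = xW t + (v t)\<^sup>2" for t
    using v(2)[of t] unfolding xeq by simp_all
  have x0': "xy 0 = (\<theta> - \<theta>0) * y0 + wmax" "xe 0 = e1" "xR 0 = r0" "xW 0 = wmax\<^sup>2"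
    using x0 unfolding xeq by simp_all
  have pos: "xR t \<ge> r0" "xW t > 0" for t using I[of t] by (simp_all add: I_def xeq)
  \<comment> \<open>\<open>x t\<close> describes time \<open>t + 1\<close>, so outputs and estimates
    shift by one. The noise shifts by two, with \<open>wmax\<close> at time 1 and a filler 0 at time
    0. \<open>xR\<close> needs no shift, since the state at time \<open>t + 1\<close> holds
    \<open>r t\<close>.\<close>
  define y where "y = case_nat y0 xy"
  define w where "w = case_nat 0 (case_nat wmax v)"
  define \<theta>h where "\<theta>h = case_nat \<theta>0 (\<lambda>t. \<theta> - xe t)"
  define u where "u t = - \<theta>h t * y t" for t
  have ySuc: "y (Suc t) = xy t" and hSuc: "\<theta>h (Suc t) = \<theta> - xe t" for t
    by (simp_all add: y_def \<theta>h_def)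
  have y': "y (Suc t) = (\<theta> - \<theta>h t) * y t + w (Suc t)" for t
    by (cases t) (simp_all add: y_def w_def \<theta>h_def xs x0')
  have r': "xR (Suc t) = xR t + (y (Suc t))\<^sup>2" for t by (simp add: ySuc xs)
  have h': "\<theta>h (Suc t) = \<theta>h t + 1 / xR t * y t * y (Suc t)" for t
    by (cases t) (simp_all add: y_def \<theta>h_def xs x0' e1_def)
  have bound: "\<forall>t\<ge>1. \<bar>w t\<bar> \<le> wmax"
    using v assms by (auto simp: w_def split: nat.split)
  have inv: "1 / xR (Suc t) = 1 / xR t - (y (Suc t))\<^sup>2 / ((xR t)\<^sup>2 + xR t * (y (Suc t))\<^sup>2)" for t
  proof -
    have a: "xR t > 0" "xR t + (y (Suc t))\<^sup>2 > 0" using pos(1)[of t] assms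
      by (auto intro: add_pos_nonneg)
    have "(xR t)\<^sup>2 + xR t * (y (Suc t))\<^sup>2 = xR t * (xR t + (y (Suc t))\<^sup>2)"
      by (simp add: power2_eq_square algebra_simps)
    with a show ?thesis by (simp add: r' divide_simps)
  qed
  have sys: "ls_self_tuning_system \<theta> r0 y0 \<theta>0 w u y xR \<theta>h"
    unfolding ls_self_tuning_system_def linear_model_def ls_estimate_def self_tuning_feedback_def
  proof (intro conjI allI impI)
    fix t :: nat
    show "y (t + 1) = \<theta> * y t + u t + w (t + 1)" using y'[of t] by (simp add: u_def algebra_simps)
    show "\<theta>h (t + 1) = \<theta>h t + 1 / xR t * y t * (y (t + 1) - u t - \<theta>h t * y t)"
      using h'[of t] by (simp add: u_def)
    show "1 / xR t = 1 / xR (t - 1) - (y t)\<^sup>2 / ((xR (t - 1))\<^sup>2 + xR (t - 1) * (y t)\<^sup>2)"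
      if "t \<ge> 1" using inv[of "t - 1"] that by simp
  qed (simp_all add: y_def \<theta>h_def x0' u_def)
  have sumy: "(\<Sum>i=1..t. (y i)\<^sup>2) = xR t - r0" for t
    by (induction t) (simp_all add: x0' r')
  have sumw: "(\<Sum>i=1..Suc t. (w i)\<^sup>2) = xW t" for t
    by (induction t) (simp_all add: x0' xs w_def)
  have "limsup (\<lambda>t. ereal \<bar>\<theta> - \<theta>h t\<bar>) = \<infinity>"
  proof (rule limsup_ereal_eq_infinity)
    fix n :: nat
    obtain t where t: "t \<ge> 2 * n" "P (2 * n) (x t)" using P by blast
    then have "real (2 * n) \<le> xe t" by (simp add: P_def xeq)
    then have "real n \<le> \<bar>\<theta> - \<theta>h (Suc t)\<bar>" by (simp add: hSuc)
    with t show "\<exists>t\<ge>n. real n \<le> \<bar>\<theta> - \<theta>h t\<bar>" by (intro exI[of _ "Suc t"]) auto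
  qed
  moreover have "limsup (\<lambda>t. ereal ((\<Sum>i=1..t. (y i)\<^sup>2) / (\<Sum>i=1..t. (w i)\<^sup>2))) = \<infinity>"
  proof (rule limsup_ereal_eq_infinity)
    fix n :: nat
    obtain t where t: "t \<ge> 2 * n + 1" "P (2 * n + 1) (x t)" using P by blast
    have "real n * xW t \<le> real (2 * n + 1) * xW t"
      using pos(2)[of t] by (intro mult_right_mono) auto
    also have "\<dots> \<le> (xy t)\<^sup>2" using t(2) by (simp add: P_def xeq)
    \<comment> \<open>The single output at time \<open>t + 1\<close> already outweighs the whole
      noise energy up to that time.\<close>
    also have "\<dots> \<le> xR (Suc t) - r0" using pos(1)[of t] by (simp add: xs)
    finally have "real n \<le> (\<Sum>i=1..Suc t. (y i)\<^sup>2) / (\<Sum>i=1..Suc t. (w i)\<^sup>2)"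
      unfolding sumy sumw using pos(2)[of t] by (simp add: pos_le_divide_eq)
    with t(1) show "\<exists>t\<ge>n. real n \<le> (\<Sum>i=1..t. (y i)\<^sup>2) / (\<Sum>i=1..t. (w i)\<^sup>2)"
      by (intro exI[of _ "Suc t"]) auto
  qed
  ultimately show ?thesis using bound sys by blast
qed

end
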